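(* Let $X\in\mathbb{R}^{n\times p}$, $\beta^0\in\mathbb{R}^p$ and $\lambda>0$. If $\beta^\star$ is an optimal solution of the noiseless Lasso problem $$\min_{\beta\in\mathbb{R}^p}\ \Big\{\tfrac1n\|X\beta-X\beta^0\|_2^2+\lambda\|\beta\|_1\Big\},$$ then $$\frac1n\|X(\beta^\star-\beta^0)\|_2^2\le\lambda\|\beta^0\|_1 .$$
   Context: $\|\cdot\|_1$ and $\|\cdot\|_2$ are the usual $\ell_1$ and $\ell_2$ norms. *)

theory Defs
  imports "HOL-Analysis.Analysis"
begin

definition l1_norm :: "real ^ 'n \<Rightarrow> real" where
  "l1_norm x = (\<Sum>i\<in>UNIV. \<bar>x $ i\<bar>)"

(* The sample size n is CARD('n), the number of rows of X; norm on real ^ 'n is the Euclidean norm. *)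
definition lasso_objective :: "real ^ 'p ^ 'n \<Rightarrow> real ^ 'n \<Rightarrow> real \<Rightarrow> real ^ 'p \<Rightarrow> real" where
  "lasso_objective X y lam \<beta> =
     1 / real CARD('n) * (norm (X *v \<beta> - y))\<^sup>2 + lam * l1_norm \<beta>"

end

theory Submission
  imports Defs
begin

theorem theorem3:
  fixes X :: "real ^ 'p ^ 'n" and \<beta>0 \<beta>star :: "real ^ 'p" and lam :: real
  assumes "lam > 0"
    and "is_arg_min (lasso_objective X (X *v \<beta>0) lam) (\<lambda>_. True) \<beta>star"
  shows "1 / real CARD('n) * (norm (X *v (\<beta>star - \<beta>0)))\<^sup>2 \<le> lam * l1_norm \<beta>0"
proof -
  have "lasso_objective X (X *v \<beta>0) lam \<beta>star \<le> lasso_objective X (X *v \<beta>0) lam \<beta>0"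
    using assms(2) by (auto simp: is_arg_min_def not_less)
  moreover have "lam * l1_norm \<beta>star \<ge> 0"
    using assms(1) by (simp add: l1_norm_def sum_nonneg)
  \<comment> \<open>Linearity of \<open>X\<close> turns the prediction error in the goal into the
    fit term at \<open>\<beta>star\<close>.\<close>
  ultimately show ?thesis
    by (simp add: lasso_objective_def matrix_vector_mult_diff_distrib)
qed

end
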